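(* Let $A$ be a bounded linear operator in a Hilbert space $H$ with $N(A)=N(A^* )=\{0\}$ and such that $A^{-1}$ is unbounded. Let $y\in H$, $f=Ay$, $f\neq0$, and let $C\in(1,2)$ be a constant. Then there exist $\delta_0>0$ and elements $f_\delta\in H$, $\delta\in(0,\delta_0)$, with $\|f_\delta-f\|\le\delta$ and $\|f_\delta\|>\delta$, such that, with $a(\delta)>0$ the solution $a$ of the equation $$\|Au_{a,\delta}-f_\delta\|=C\delta,\qquad u_{a,\delta}:=T_a^{-1}A^*f_\delta ,$$ and $u_\delta:=u_{a(\delta),\delta}=T_{a(\delta)}^{-1}A^*f_\delta$, one has $$\lim_{\delta\to0}\ \sup_{v\in S_\delta}\|u_\delta-v\|\ \ge\ c>0,$$ where $c$ is a constant and $S_\delta:=\{v\in H:\|Av-f_\delta\|\le\delta\}$.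
   Context: $N(B)$ denotes the null space of an operator $B$; $A^*$ is the adjoint of $A$; $T=A^*A$, $T_a=T+aI$ for $a>0$, $I$ the identity. The supremum and the limit are taken in $[0,\infty]$. *)

theory Defs
  imports "HOL-Analysis.Analysis"
begin

definition null_space :: "('a::real_vector \<Rightarrow> 'b::real_vector) \<Rightarrow> 'a set" where
  "null_space B = {x. B x = 0}"

text \<open>The inverse of an injective operator is defined on its range only.\<close>

definition unbounded_inverse :: "('a::real_normed_vector \<Rightarrow> 'b::real_normed_vector) \<Rightarrow> bool" where
  "unbounded_inverse A \<longleftrightarrow> \<not> (\<exists>K. \<forall>w\<in>range A. norm (inv A w) \<le> K * norm w)"

definition shifted_normal_op :: "('a::real_inner \<Rightarrow> 'a) \<Rightarrow> real \<Rightarrow> 'a \<Rightarrow> 'a" where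
  "shifted_normal_op A a x = adjoint A (A x) + a *\<^sub>R x"

definition regularized_solution :: "('a::real_inner \<Rightarrow> 'a) \<Rightarrow> real \<Rightarrow> 'a \<Rightarrow> 'a" where
  "regularized_solution A a g = inv (shifted_normal_op A a) (adjoint A g)"

definition admissible_set :: "('a::real_normed_vector \<Rightarrow> 'a) \<Rightarrow> 'a \<Rightarrow> real \<Rightarrow> 'a set" where
  "admissible_set A g \<delta> = {v. norm (A v - g) \<le> \<delta>}"

text \<open>
  Hilbert spaces are rendered as complete real inner product spaces. This includes the complex
  ones: a complex Hilbert space is a real one under the real part of its inner product, with the
  same norm, and the following fact shows that the adjoint is unchanged as well.
\<close>

lemma adjoint_of_complex_adjoint:
  fixes cip :: "'a::real_inner \<Rightarrow> 'a \<Rightarrow> complex"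
  assumes "\<And>x y. Re (cip x y) = x \<bullet> y"
    and "\<And>x y. cip (A x) y = cip x (B y)"
  shows "adjoint A = B"
  by (rule adjoint_unique) (metis assms)

end

theory Submission
  imports Defs
begin

text \<open>
  The exact data \<open>f\<^sub>\<delta> = f = A y\<close> already witness the claim. The element \<open>y\<close> lies well inside the
  admissible set, because \<open>\<parallel>A y - f\<parallel> = 0 < \<delta>\<close>, and since \<open>A\<^sup>-\<^sup>1\<close> is unbounded there are arbitrarily
  long vectors \<open>x\<close> with \<open>\<parallel>A x\<parallel> = \<delta>\<close>; every such \<open>y + x\<close> is admissible. Hence the admissible set is
  unbounded for each \<open>\<delta> > 0\<close>, its elements are at infinite maximal distance from any fixed vector
  (\<open>SUP_admissible_set_eq_top\<close>), and the limit in question is that of the constant \<open>\<infinity>\<close>.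

  The analytic work is to show that the discrepancy principle has exactly one solution for these
  data when \<open>0 < C \<delta> < \<parallel>f\<parallel>\<close> (\<open>discrepancy_principle_solvable\<close>), which holds for \<open>\<delta> < \<parallel>f\<parallel> / C\<close>. In
  place of the spectral theorem, everything is read off the weak normal equation
  \<open>a \<langle>u, z\<rangle> = \<langle>g - A u, A z\<rangle>\<close> for all \<open>z\<close>, which the regularized solution \<open>u\<close> for the parameter \<open>a\<close>
  and the data \<open>g\<close> satisfies. Testing it with suitable vectors \<open>z\<close> shows that
  \<open>a \<mapsto> \<parallel>A u - A y\<parallel>\<close> is strictly increasing and continuous, is at most \<open>\<surd>a \<parallel>y\<parallel>\<close>, and comes
  arbitrarily close to \<open>\<parallel>A y\<parallel>\<close> for large \<open>a\<close>; the intermediate value theorem does the rest.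

  For the weak normal equation the adjoint of \<open>A\<close> has to exist and \<open>A\<^sup>*A + a I\<close> has to be onto. Both
  follow from one variational principle, \<open>symmetric_Lax_Milgram\<close>.
\<close>

section \<open>Existence of adjoints and of regularized solutions\<close>

text \<open>
  The solution minimizes the energy \<open>J x = B x x - 2 l x\<close>. Coercivity bounds \<open>J\<close> below, and by the
  parallelogram identity it forces minimizing sequences to be Cauchy; at a minimizer the first
  variation \<open>2 (B x z - l z)\<close> vanishes. With the inner product for \<open>B\<close> this is the Riesz
  representation theorem.
\<close>

lemma symmetric_Lax_Milgram:
  fixes B :: "'a::{real_inner, complete_space} \<Rightarrow> 'a \<Rightarrow> real"
  assumes B: "bounded_bilinear B"
    and sym: "\<And>x z. B x z = B z x"
    and "0 < c" and coercive: "\<And>x. c * (norm x)\<^sup>2 \<le> B x x"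
    and l: "bounded_linear l"
  shows "\<exists>x. \<forall>z. B x z = l z"
proof -
  interpret B: bounded_bilinear B by (rule B)
  interpret l: bounded_linear l by (rule l)
  define J where "J x = B x x - 2 * l x" for x
  have bdd: "bdd_below (range J)"
  proof -
    obtain M where M: "\<And>x. norm (l x) \<le> norm x * M"
      using l.bounded by blast
    have "- (M\<^sup>2 / c) \<le> J x" for x
    proof -
      have "l x \<le> norm x * M" using M[of x] by simp
      then have "J x \<ge> c * (norm x)\<^sup>2 - 2 * (norm x * M)"
        using coercive[of x] by (simp add: J_def)
      moreover have "c * (norm x)\<^sup>2 - 2 * (norm x * M) + M\<^sup>2 / c = (c * norm x - M)\<^sup>2 / c"
        using \<open>0 < c\<close> by (simp add: field_simps power2_eq_square)
      moreover have "(c * norm x - M)\<^sup>2 / c \<ge> 0" using \<open>0 < c\<close> by simp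
      ultimately show ?thesis by linarith
    qed
    then show ?thesis by (intro bdd_belowI[of _ "- (M\<^sup>2 / c)"]) auto
  qed
  define m where "m = Inf (range J)"
  have m: "m \<le> J x" for x
    unfolding m_def by (rule cInf_lower[OF _ bdd]) simp
  have "\<exists>x. J x < m + inverse (real (Suc n))" for n
    using cInf_lessD[of "range J" "m + inverse (real (Suc n))"] by (auto simp: m_def)
  then obtain X where X: "\<And>n. J (X n) < m + inverse (real (Suc n))" by metis
  have parallelogram: "J x + J z = 2 * J ((1/2) *\<^sub>R (x + z)) + (1/2) * B (x - z) (x - z)" for x z
    using sym[of x z]
    by (simp add: J_def B.add_left B.add_right B.diff_left B.diff_right B.scaleR_left
        B.scaleR_right l.add l.scaleR field_simps)
  have close: "c * (norm (x - z))\<^sup>2 \<le> 2 * (J x + J z - 2 * m)" for x z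
  proof -
    define h where "h = (1/2) *\<^sub>R (x + z)"
    have "J x + J z = 2 * J h + (1/2) * B (x - z) (x - z)"
      unfolding h_def by (rule parallelogram)
    then show ?thesis using m[of h] coercive[of "x - z"] by (simp add: algebra_simps)
  qed
  have "Cauchy X"
  proof (rule metric_CauchyI)
    fix e :: real assume "0 < e"
    then obtain N where N: "inverse (real (Suc N)) < c * e\<^sup>2 / 4"
      using reals_Archimedean[of "c * e\<^sup>2 / 4"] \<open>0 < c\<close> by auto
    have small: "J (X n) < m + c * e\<^sup>2 / 4" if "N \<le> n" for n
    proof -
      have "inverse (real (Suc n)) \<le> inverse (real (Suc N))"
        using that by (intro le_imp_inverse_le) auto
      then show ?thesis using X[of n] N by linarith
    qed
    have "dist (X i) (X j) < e" if "N \<le> i" "N \<le> j" for i j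
    proof -
      have "c * (norm (X i - X j))\<^sup>2 < c * e\<^sup>2"
        using close[of "X i" "X j"] small[OF that(1)] small[OF that(2)] by argo
      then have "(norm (X i - X j))\<^sup>2 < e\<^sup>2" using \<open>0 < c\<close> by simp
      then show ?thesis using \<open>0 < e\<close> by (simp add: dist_norm power_less_imp_less_base)
    qed
    then show "\<exists>M. \<forall>i\<ge>M. \<forall>j\<ge>M. dist (X i) (X j) < e" by blast
  qed
  then obtain x where x: "X \<longlonglongrightarrow> x" by (auto simp: Cauchy_convergent_iff convergent_def)
  have "(\<lambda>n. J (X n)) \<longlonglongrightarrow> J x"
    unfolding J_def by (intro tendsto_intros B.tendsto l.tendsto x)
  moreover have "(\<lambda>n. m + inverse (real (Suc n))) \<longlonglongrightarrow> m"
    by (rule LIMSEQ_inverse_real_of_nat_add)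
  ultimately have "J x \<le> m"
    by (rule LIMSEQ_le) (use X in \<open>auto intro: less_imp_le\<close>)
  then have minimal: "J x \<le> J z" for z using m[of z] by linarith
  have "B x z = l z" for z
  proof -
    define g where "g = B x z - l z"
    have quadratic: "0 \<le> t\<^sup>2 * B z z + 2 * t * g" for t
    proof -
      have "J (x + t *\<^sub>R z) = J x + (t\<^sup>2 * B z z + 2 * t * g)"
        using sym[of x z]
        by (simp add: J_def g_def B.add_left B.add_right B.scaleR_left B.scaleR_right
            l.add l.scaleR power2_eq_square algebra_simps)
      then show ?thesis using minimal[of "x + t *\<^sub>R z"] by linarith
    qed
    have "B z z \<ge> 0" using coercive[of z] \<open>0 < c\<close> by (meson order_trans mult_nonneg_nonneg less_imp_le zero_le_power2)
    then have pos: "B z z + 1 > 0" by simp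
    \<comment> \<open>The minimizing \<open>t\<close> would be \<open>- g / B z z\<close>; adding 1 keeps the denominator positive when \<open>z = 0\<close>.\<close>
    have "0 \<le> (- g / (B z z + 1))\<^sup>2 * B z z + 2 * (- g / (B z z + 1)) * g"
      by (rule quadratic)
    also have "\<dots> = - (g\<^sup>2 * (B z z + 2) / (B z z + 1)\<^sup>2)"
      using pos by (simp add: divide_simps) (simp add: power2_eq_square algebra_simps)
    finally have "g\<^sup>2 * (B z z + 2) / (B z z + 1)\<^sup>2 \<le> 0" by simp
    then have "g\<^sup>2 * (B z z + 2) \<le> 0" using pos by (simp add: divide_le_0_iff)
    then have "g\<^sup>2 \<le> 0" using pos by (simp add: mult_le_0_iff)
    then show ?thesis by (simp add: g_def)
  qed
  then show ?thesis by blast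
qed

text \<open>
  Adjoints are obtained by choice, so their defining property rests on the existence of some
  adjoint, which is the Riesz representation of the functionals \<open>x \<mapsto> \<langle>y, A x\<rangle>\<close>.
\<close>

lemma adjoint_works_complete:
  fixes A :: "'a::{real_inner, complete_space} \<Rightarrow> 'b::real_inner"
  assumes "bounded_linear A"
  shows "A x \<bullet> y = x \<bullet> adjoint A y"
proof -
  interpret A: bounded_linear A by (rule assms)
  have "\<exists>w. \<forall>x. w \<bullet> x = y \<bullet> A x" for y
  proof (rule symmetric_Lax_Milgram[where c = 1])
    show "bounded_linear (\<lambda>x. y \<bullet> A x)"
      by (rule bounded_linear_compose[OF bounded_linear_inner_right assms])
  qed (auto simp: bounded_bilinear_inner inner_commute power2_norm_eq_inner)
  then obtain B where "\<And>y x. B y \<bullet> x = y \<bullet> A x" by metis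
  then have "\<forall>x y. A x \<bullet> y = x \<bullet> B y" by (simp add: inner_commute)
  then have "\<forall>x y. A x \<bullet> y = x \<bullet> adjoint A y"
    unfolding adjoint_def by (rule someI[where P = "\<lambda>B. \<forall>x y. A x \<bullet> y = x \<bullet> B y"])
  then show ?thesis by blast
qed

text \<open>
  The equation \<open>A\<^sup>*A x + a x = g\<close> in weak form involves the bilinear form
  \<open>\<langle>A x, A z\<rangle> + a \<langle>x, z\<rangle>\<close>, for which \<open>a\<close> itself is a coercivity constant.
\<close>

lemma surj_shifted_normal_op:
  fixes A :: "'a::{real_inner, complete_space} \<Rightarrow> 'a"
  assumes A: "bounded_linear A" and "0 < a"
  shows "surj (shifted_normal_op A a)"
proof -
  interpret A: bounded_linear A by (rule A)
  have "\<exists>x. shifted_normal_op A a x = g" for g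
  proof -
    have "\<exists>x. \<forall>z. A x \<bullet> A z + a * (x \<bullet> z) = g \<bullet> z"
    proof (rule symmetric_Lax_Milgram[where c = a])
      \<comment> \<open>The form is an inner product in the product space, composed with bounded linear maps.\<close>
      have "bounded_bilinear (\<lambda>x z. (A x, a *\<^sub>R x) \<bullet> (A z, z))"
        by (intro bounded_bilinear.comp[OF bounded_bilinear_inner] bounded_linear_Pair A
            bounded_linear_scaleR_right bounded_linear_ident)
      then show "bounded_bilinear (\<lambda>x z. A x \<bullet> A z + a * (x \<bullet> z))"
        by (simp add: inner_Pair)
    qed (auto simp: \<open>0 < a\<close> inner_commute power2_norm_eq_inner bounded_linear_inner_right)
    then obtain x where "\<And>z. A x \<bullet> A z + a * (x \<bullet> z) = g \<bullet> z" by blast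
    then have "z \<bullet> shifted_normal_op A a x = z \<bullet> g" for z
      unfolding shifted_normal_op_def inner_add_right adjoint_works_complete[OF A, symmetric]
      by (metis inner_commute inner_scaleR_left)
    then show ?thesis by (metis vector_eq_ldot)
  qed
  then show ?thesis by (metis surjI)
qed

text \<open>
  The weak form of \<open>A\<^sup>*A u + a u = A\<^sup>* g\<close>. It mentions neither the adjoint nor an inverse operator and
  is the only property of regularized solutions that the rest of the argument relies on.
\<close>

lemma regularized_solution_normal_equation:
  fixes A :: "'a::{real_inner, complete_space} \<Rightarrow> 'a"
  assumes A: "bounded_linear A" and "0 < a"
  shows "a * (regularized_solution A a g \<bullet> z) = (g - A (regularized_solution A a g)) \<bullet> A z"
proof -
  define u where "u = regularized_solution A a g"
  have "shifted_normal_op A a u = adjoint A g"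
    unfolding u_def regularized_solution_def
    by (rule surj_f_inv_f[OF surj_shifted_normal_op[OF assms]])
  then have "z \<bullet> adjoint A (A u) + z \<bullet> (a *\<^sub>R u) = z \<bullet> adjoint A g"
    by (metis shifted_normal_op_def inner_add_right)
  then show ?thesis
    unfolding u_def[symmetric]
    by (simp add: adjoint_works_complete[OF A, symmetric] inner_diff_left inner_commute[of z]
        inner_commute[of "A z"])
qed

section \<open>The discrepancy as a function of the regularization parameter\<close>

text \<open>
  Subtract the weak normal equations of \<open>u\<close> and \<open>v\<close> and test the difference with \<open>u - v\<close>. The
  identity gives a sign to \<open>\<langle>u - v, v\<rangle>\<close>, whence monotonicity of the discrepancy, and controls
  \<open>\<parallel>A (u - v)\<parallel>\<close> by \<open>b - a\<close>, whence continuity.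
\<close>

lemma regularized_solution_difference:
  fixes A :: "'a::{real_inner, complete_space} \<Rightarrow> 'a" and a b :: real and g :: 'a
  defines "u \<equiv> regularized_solution A a g" and "v \<equiv> regularized_solution A b g"
  assumes A: "bounded_linear A" and "0 < a" "0 < b"
  shows "(b - a) * ((u - v) \<bullet> v) = (norm (A (u - v)))\<^sup>2 + a * (norm (u - v))\<^sup>2"
proof -
  interpret A: bounded_linear A by (rule A)
  define d where "d = u - v"
  have "a * (u \<bullet> d) = (g - A u) \<bullet> A d" "b * (v \<bullet> d) = (g - A v) \<bullet> A d"
    using regularized_solution_normal_equation[OF A] assms by auto
  moreover have "A u = A v + A d" "u = v + d" by (auto simp: d_def A.diff)
  ultimately show ?thesis
    unfolding d_def[symmetric] power2_norm_eq_inner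
    by (simp add: inner_add_left inner_diff_left inner_commute[of v d] algebra_simps)
qed

text \<open>
  With \<open>d = u - v\<close>, the difference of the squared discrepancies factors as
  \<open>\<langle>(A y - A v) + (A y - A u), A d\<rangle>\<close>, and the normal equations turn this into
  \<open>\<langle>b v + a u, d\<rangle> = (a + b) \<langle>d, v\<rangle> + a \<parallel>d\<parallel>\<^sup>2\<close>, which is positive unless \<open>d = 0\<close>. The latter would mean
  that two different parameters share a regularized solution; such a solution is \<open>0\<close> and leaves the
  residual \<open>A y\<close> orthogonal to the range of \<open>A\<close>.
\<close>

lemma discrepancy_strict_mono:
  fixes A :: "'a::{real_inner, complete_space} \<Rightarrow> 'a"
  assumes A: "bounded_linear A" and "A y \<noteq> 0" and "0 < a" "a < b"
  shows "norm (A (regularized_solution A a (A y)) - A y) < norm (A (regularized_solution A b (A y)) - A y)"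
proof -
  interpret A: bounded_linear A by (rule A)
  define u where "u = regularized_solution A a (A y)"
  define v where "v = regularized_solution A b (A y)"
  define d where "d = u - v"
  have eq_u: "a * (u \<bullet> z) = (A y - A u) \<bullet> A z" and eq_v: "b * (v \<bullet> z) = (A y - A v) \<bullet> A z" for z
    using regularized_solution_normal_equation[OF A] assms unfolding u_def v_def by auto
  have "d \<noteq> 0"
  proof
    assume "d = 0"
    then have "u = v" by (simp add: d_def)
    then have "(b - a) * (u \<bullet> u) = 0"
      using eq_u[of u] eq_v[of u] by (simp add: left_diff_distrib)
    then have "u = 0" using \<open>a < b\<close> by simp
    then have "A y \<bullet> A y = 0" using eq_u[of y] by simp
    then show False using \<open>A y \<noteq> 0\<close> by simp
  qed
  have "(norm (A y - A v))\<^sup>2 - (norm (A y - A u))\<^sup>2 = (A y - A v) \<bullet> A d + (A y - A u) \<bullet> A d"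
    unfolding d_def A.diff power2_norm_eq_inner by (simp add: algebra_simps inner_commute)
  also have "\<dots> = b * (v \<bullet> d) + a * (u \<bullet> d)" by (simp add: eq_u eq_v)
  also have "\<dots> = (a + b) * (d \<bullet> v) + a * (norm d)\<^sup>2"
    unfolding d_def power2_norm_eq_inner by (simp add: algebra_simps inner_commute)
  also have "\<dots> > 0"
  proof -
    have "(b - a) * (d \<bullet> v) = (norm (A d))\<^sup>2 + a * (norm d)\<^sup>2"
      using regularized_solution_difference[OF A, of a b "A y"] assms
      by (simp add: u_def v_def d_def)
    then have "(b - a) * (d \<bullet> v) \<ge> 0" using \<open>0 < a\<close> by simp
    then have "d \<bullet> v \<ge> 0" using \<open>a < b\<close> by (simp add: zero_le_mult_iff)
    moreover have "a * (norm d)\<^sup>2 > 0" using \<open>0 < a\<close> \<open>d \<noteq> 0\<close> by simp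
    ultimately show ?thesis using \<open>0 < a\<close> \<open>a < b\<close> by (simp add: add_nonneg_pos)
  qed
  finally have "(norm (A y - A u))\<^sup>2 < (norm (A y - A v))\<^sup>2" by simp
  then have "norm (A y - A u) < norm (A y - A v)"
    by (rule power_less_imp_less_base) simp
  then show ?thesis by (simp add: u_def v_def norm_minus_commute)
qed

text \<open>
  Testing the normal equation with \<open>y - u\<close> gives \<open>a \<langle>u, y - u\<rangle> = \<parallel>A u - A y\<parallel>\<^sup>2\<close>. So \<open>\<langle>u, y - u\<rangle>\<close> is
  nonnegative, which bounds \<open>u\<close>, and it is at most \<open>\<parallel>u\<parallel> \<parallel>y\<parallel>\<close>, which bounds the discrepancy.
\<close>

lemma regularized_solution_exact_data_bounds:
  fixes A :: "'a::{real_inner, complete_space} \<Rightarrow> 'a"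
  assumes A: "bounded_linear A" and "0 < a"
  shows norm_regularized_solution_le: "norm (regularized_solution A a (A y)) \<le> norm y"
    and discrepancy_le: "(norm (A (regularized_solution A a (A y)) - A y))\<^sup>2 \<le> a * (norm y)\<^sup>2"
proof -
  interpret A: bounded_linear A by (rule A)
  define u where "u = regularized_solution A a (A y)"
  have eq: "a * (u \<bullet> y - u \<bullet> u) = (norm (A u - A y))\<^sup>2"
    using regularized_solution_normal_equation[OF assms, of "A y" "y - u"]
    unfolding u_def[symmetric]
    by (simp add: A.diff inner_diff_right power2_norm_eq_inner inner_diff_left algebra_simps inner_commute)
  then have "0 \<le> a * (u \<bullet> y - u \<bullet> u)" by simp
  then have "u \<bullet> u \<le> u \<bullet> y" using \<open>0 < a\<close> by (simp add: zero_le_mult_iff)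
  then have le: "norm u * norm u \<le> norm u * norm y"
    using norm_cauchy_schwarz[of u y] by (simp add: power2_eq_square flip: power2_norm_eq_inner)
  then show *: "norm (regularized_solution A a (A y)) \<le> norm y"
    unfolding u_def[symmetric] by (cases "u = 0") auto
  have "u \<bullet> y - u \<bullet> u \<le> norm u * norm y"
    using norm_cauchy_schwarz[of u y] inner_ge_zero[of u] by linarith
  also have "\<dots> \<le> (norm y)\<^sup>2"
    using * unfolding u_def[symmetric] power2_eq_square by (intro mult_right_mono) auto
  finally show "(norm (A (regularized_solution A a (A y)) - A y))\<^sup>2 \<le> a * (norm y)\<^sup>2"
    unfolding u_def[symmetric] eq[symmetric] using \<open>0 < a\<close> by simp
qed

text \<open>
  By \<open>regularized_solution_difference\<close> and the uniform bound on regularized solutions, \<open>A u\<close> is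
  even Hoelder continuous of exponent 1/2 in the parameter.
\<close>

lemma discrepancy_continuous:
  fixes A :: "'a::{real_inner, complete_space} \<Rightarrow> 'a"
  assumes A: "bounded_linear A"
  shows "continuous_on {0<..} (\<lambda>a. norm (A (regularized_solution A a (A y)) - A y))"
proof -
  interpret A: bounded_linear A by (rule A)
  let ?u = "\<lambda>a. regularized_solution A a (A y)"
  have hoelder: "(norm (A (?u b) - A (?u a)))\<^sup>2 \<le> 2 * (norm y)\<^sup>2 * \<bar>b - a\<bar>"
    if "0 < a" "0 < b" for a b
  proof -
    let ?d = "?u b - ?u a"
    have "(norm (A ?d))\<^sup>2 \<le> (a - b) * (?d \<bullet> ?u a)"
      using regularized_solution_difference[OF A, of b a "A y"] that by simp
    also have "\<dots> \<le> \<bar>b - a\<bar> * (norm ?d * norm (?u a))"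
    proof -
      have "(a - b) * (?d \<bullet> ?u a) \<le> \<bar>a - b\<bar> * \<bar>?d \<bullet> ?u a\<bar>"
        by (metis abs_ge_self abs_mult)
      also have "\<dots> \<le> \<bar>a - b\<bar> * (norm ?d * norm (?u a))"
        by (intro mult_left_mono Cauchy_Schwarz_ineq2) auto
      finally show ?thesis by (simp add: abs_minus_commute)
    qed
    also have "\<dots> \<le> \<bar>b - a\<bar> * ((2 * norm y) * norm y)"
      using norm_regularized_solution_le[OF A, of a y] norm_regularized_solution_le[OF A, of b y]
        norm_triangle_ineq4[of "?u b" "?u a"] that
      by (intro mult_left_mono mult_mono) auto
    finally show ?thesis by (simp add: A.diff power2_eq_square mult_ac)
  qed
  have "continuous_on {0<..} (\<lambda>a. A (?u a))"
    unfolding continuous_on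
  proof
    fix a :: real assume a: "a \<in> {0<..}"
    have "((\<lambda>b. sqrt (2 * (norm y)\<^sup>2 * \<bar>b - a\<bar>)) \<longlongrightarrow> sqrt (2 * (norm y)\<^sup>2 * \<bar>a - a\<bar>)) (at a within {0<..})"
      by (intro tendsto_intros)
    then have "((\<lambda>b. sqrt (2 * (norm y)\<^sup>2 * \<bar>b - a\<bar>)) \<longlongrightarrow> 0) (at a within {0<..})" by simp
    then show "((\<lambda>b. A (?u b)) \<longlongrightarrow> A (?u a)) (at a within {0<..})"
      by (rule Lim_transform_bound[rotated, THEN LIM_zero_cancel])
         (use a hoelder in \<open>auto simp: eventually_at_filter intro!: always_eventually real_le_rsqrt\<close>)
  qed
  then show ?thesis by (intro continuous_intros)
qed

text \<open>
  Testing the normal equation with \<open>u\<close> itself gives \<open>b \<parallel>u\<parallel>\<^sup>2 \<le> \<parallel>g\<parallel>\<^sup>2\<close>, so \<open>A u\<close> tends to \<open>0\<close> as \<open>b\<close> grows,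
  and the discrepancy tends to \<open>\<parallel>g\<parallel>\<close>.
\<close>

lemma discrepancy_arbitrarily_close_to_norm:
  fixes A :: "'a::{real_inner, complete_space} \<Rightarrow> 'a"
  assumes A: "bounded_linear A" and "\<eta> < norm g"
  obtains b where "0 < b" "\<eta> < norm (A (regularized_solution A b g) - g)"
proof -
  interpret A: bounded_linear A by (rule A)
  obtain K where "K > 0" and K: "\<And>x. norm (A x) \<le> norm x * K"
    using A.pos_bounded by blast
  define e where "e = (norm g - \<eta>) / 2"
  have "e > 0" using assms by (simp add: e_def)
  \<comment> \<open>Chosen so that \<open>\<parallel>u\<parallel> \<le> \<parallel>g\<parallel> / \<surd>b\<close> yields \<open>K \<parallel>u\<parallel> \<le> e\<close>; using \<open>\<parallel>g\<parallel> + 1\<close> keeps \<open>b\<close> positive when \<open>g = 0\<close>.\<close>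
  define b where "b = (K * (norm g + 1) / e)\<^sup>2"
  have "K * (norm g + 1) / e > 0" using \<open>K > 0\<close> \<open>e > 0\<close> by (simp add: add_nonneg_pos)
  then have "b > 0" unfolding b_def by (rule zero_less_power)
  define u where "u = regularized_solution A b g"
  have "b * (norm u)\<^sup>2 = g \<bullet> A u - (norm (A u))\<^sup>2"
    using regularized_solution_normal_equation[OF A \<open>b > 0\<close>, of g u]
    by (simp add: u_def power2_norm_eq_inner inner_diff_left)
  also have "\<dots> \<le> (norm g)\<^sup>2"
  proof -
    have "0 \<le> (norm (g - A u))\<^sup>2" by simp
    also have "\<dots> = (norm g)\<^sup>2 - 2 * (g \<bullet> A u) + (norm (A u))\<^sup>2"
      unfolding power2_norm_eq_inner by (simp add: algebra_simps inner_commute)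
    finally show ?thesis by (smt (verit) zero_le_power2)
  qed
  finally have "(K * (norm g + 1) / e * norm u)\<^sup>2 \<le> (norm g)\<^sup>2"
    by (simp add: b_def power_mult_distrib[of _ "norm u"] del: times_divide_eq_left)
  then have "K * (norm g + 1) / e * norm u \<le> norm g" by (rule power2_le_imp_le) simp
  then have "norm u * K * (norm g + 1) \<le> e * norm g"
    using \<open>e > 0\<close> by (simp add: field_simps)
  also have "\<dots> \<le> e * (norm g + 1)" using \<open>e > 0\<close> by simp
  finally have "norm u * K \<le> e" by (simp add: add_nonneg_pos)
  then have "norm (A u) \<le> e" using K[of u] by linarith
  then have "norm (A u - g) \<ge> norm g - e"
    using norm_triangle_ineq2[of g "A u"] by (simp add: norm_minus_commute)
  moreover have "norm g - e > \<eta>" using assms by (simp add: e_def field_simps)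
  ultimately show thesis using that[OF \<open>b > 0\<close>] by (simp add: u_def)
qed

lemma discrepancy_principle_solvable:
  fixes A :: "'a::{real_inner, complete_space} \<Rightarrow> 'a"
  assumes A: "bounded_linear A" and "0 < \<eta>" "\<eta> < norm (A y)"
  shows "\<exists>!a. 0 < a \<and> norm (A (regularized_solution A a (A y)) - A y) = \<eta>"
proof -
  define \<phi> where "\<phi> a = norm (A (regularized_solution A a (A y)) - A y)" for a
  interpret A: bounded_linear A by (rule A)
  have "A y \<noteq> 0" using assms by auto
  obtain b where b: "0 < b" "\<eta> < \<phi> b"
    using discrepancy_arbitrarily_close_to_norm[OF A assms(3)] unfolding \<phi>_def by blast
  have mono: "\<phi> s < \<phi> t" if "0 < s" "s < t" for s t
    unfolding \<phi>_def by (rule discrepancy_strict_mono[OF A \<open>A y \<noteq> 0\<close> that])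
  have "norm y > 0" using \<open>A y \<noteq> 0\<close> by auto
  \<comment> \<open>At this parameter the bound \<open>\<surd>s \<parallel>y\<parallel>\<close> on the discrepancy equals \<open>\<eta>\<close>.\<close>
  define s where "s = (\<eta> / norm y)\<^sup>2"
  have "s > 0" using \<open>norm y > 0\<close> \<open>0 < \<eta>\<close> by (simp add: s_def)
  have "(\<phi> s)\<^sup>2 \<le> \<eta>\<^sup>2"
    using discrepancy_le[OF A \<open>s > 0\<close>, of y] \<open>norm y > 0\<close>
    by (simp add: \<phi>_def s_def power_divide)
  then have "\<phi> s \<le> \<eta>" by (rule power2_le_imp_le) (use \<open>0 < \<eta>\<close> in simp)
  have "s \<le> b"
  proof (rule ccontr)
    assume "\<not> s \<le> b"
    then have "\<phi> b < \<phi> s" using mono[of b s] \<open>0 < b\<close> by simp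
    then show False using \<open>\<phi> s \<le> \<eta>\<close> \<open>\<eta> < \<phi> b\<close> by linarith
  qed
  moreover have "continuous_on {s..b} \<phi>"
    unfolding \<phi>_def
    by (rule continuous_on_subset[OF discrepancy_continuous[OF A]]) (use \<open>s > 0\<close> in auto)
  ultimately obtain a where "s \<le> a" "\<phi> a = \<eta>"
    using IVT'[of \<phi> s \<eta> b] \<open>\<phi> s \<le> \<eta>\<close> b by auto
  have "\<exists>!a. 0 < a \<and> \<phi> a = \<eta>"
  proof (rule ex1I[of _ a])
    show "0 < a \<and> \<phi> a = \<eta>" using \<open>s > 0\<close> \<open>s \<le> a\<close> \<open>\<phi> a = \<eta>\<close> by simp
    show "a' = a" if "0 < a' \<and> \<phi> a' = \<eta>" for a'
      using mono[of a a'] mono[of a' a] that \<open>s > 0\<close> \<open>s \<le> a\<close> \<open>\<phi> a = \<eta>\<close>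
      by (cases a a' rule: linorder_cases) auto
  qed
  then show ?thesis by (simp add: \<phi>_def)
qed

section \<open>Unboundedness of the set of admissible approximate solutions\<close>

text \<open>
  Unboundedness of the inverse supplies a vector \<open>x\<close> that is arbitrarily long compared with \<open>A x\<close>.
  Scaled so that \<open>\<parallel>A x\<parallel> = \<delta>\<close>, it can be added to \<open>y\<close> without leaving the admissible set.
\<close>

lemma SUP_admissible_set_eq_top:
  fixes A :: "'a::real_normed_vector \<Rightarrow> 'a"
  assumes A: "bounded_linear A" and "null_space A = {0}" and unb: "unbounded_inverse A"
    and "0 < \<delta>"
  shows "(SUP v\<in>admissible_set A (A y) \<delta>. ennreal (norm (u - v))) = top"
proof (rule ennreal_SUP_eq_top)
  interpret A: bounded_linear A by (rule A)
  fix n :: nat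
  have "inj A"
    using \<open>null_space A = {0}\<close> by (auto simp: linear_injective_0[OF A.linear_axioms] null_space_def)
  \<comment> \<open>A vector longer than \<open>K \<delta>\<close> reaches distance \<open>n\<close> from \<open>u\<close> even after the detour from \<open>u\<close> to \<open>y\<close>.\<close>
  define K where "K = (real n + norm (u - y)) / \<delta>"
  have "K \<ge> 0" using \<open>0 < \<delta>\<close> by (simp add: K_def)
  obtain x where x: "norm x > K * norm (A x)"
    using unb \<open>inj A\<close> unfolding unbounded_inverse_def by (auto simp: not_le)
  then have "norm x > 0"
    using \<open>K \<ge> 0\<close> by (meson le_less_trans mult_nonneg_nonneg norm_ge_zero)
  then have "A x \<noteq> 0"
    using \<open>null_space A = {0}\<close> by (auto simp: null_space_def)
  define t where "t = \<delta> / norm (A x)"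
  have "t > 0" using \<open>0 < \<delta>\<close> \<open>A x \<noteq> 0\<close> by (simp add: t_def)
  define v where "v = y + t *\<^sub>R x"
  have "v \<in> admissible_set A (A y) \<delta>"
    using \<open>A x \<noteq> 0\<close> \<open>0 < \<delta>\<close> by (simp add: admissible_set_def v_def A.add A.scaleR t_def)
  moreover have "real n \<le> norm (u - v)"
  proof -
    have "real n + norm (u - y) = t * (K * norm (A x))"
      using \<open>A x \<noteq> 0\<close> \<open>0 < \<delta>\<close> by (simp add: K_def t_def)
    also have "\<dots> \<le> norm (t *\<^sub>R x)"
      using x \<open>t > 0\<close> by simp
    also have "\<dots> \<le> norm (u - y) + norm (u - v)"
      using norm_triangle_ineq4[of "u - y" "u - v"] by (simp add: v_def)
    finally show ?thesis by simp
  qed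
  then have "of_nat n \<le> ennreal (norm (u - v))"
    by (simp add: ennreal_of_nat_eq_real_of_nat ennreal_leI)
  ultimately show "\<exists>v\<in>admissible_set A (A y) \<delta>. of_nat n \<le> ennreal (norm (u - v))"
    by blast
qed

theorem theorem8:
  fixes A :: "'a::{real_inner, complete_space} \<Rightarrow> 'a"
    and y f :: 'a and C :: real
  assumes "bounded_linear A"
    and "null_space A = {0}"
    and "null_space (adjoint A) = {0}"
    and "unbounded_inverse A"
    and "f = A y"
    and "f \<noteq> 0"
    and "1 < C" and "C < 2"
  shows "\<exists>\<delta>\<^sub>0>0. \<exists>(f\<^sub>\<delta> :: real \<Rightarrow> 'a) (a :: real \<Rightarrow> real).
    (\<forall>\<delta>\<in>{0<..<\<delta>\<^sub>0}.
        norm (f\<^sub>\<delta> \<delta> - f) \<le> \<delta> \<and> norm (f\<^sub>\<delta> \<delta>) > \<delta> \<and>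
        a \<delta> > 0 \<and>
        norm (A (regularized_solution A (a \<delta>) (f\<^sub>\<delta> \<delta>)) - f\<^sub>\<delta> \<delta>) = C * \<delta> \<and>
        (\<forall>b>0. norm (A (regularized_solution A b (f\<^sub>\<delta> \<delta>)) - f\<^sub>\<delta> \<delta>) = C * \<delta> \<longrightarrow> b = a \<delta>)) \<and>
    (\<exists>c>0. \<exists>L::ennreal.
        ((\<lambda>\<delta>. SUP v\<in>admissible_set A (f\<^sub>\<delta> \<delta>) \<delta>.
            ennreal (norm (regularized_solution A (a \<delta>) (f\<^sub>\<delta> \<delta>) - v))) \<longlongrightarrow> L) (at_right 0) \<and>
        ennreal c \<le> L)"
proof -
  define \<delta>\<^sub>0 where "\<delta>\<^sub>0 = norm f / C"
  have "\<delta>\<^sub>0 > 0" using \<open>f \<noteq> 0\<close> \<open>1 < C\<close> by (simp add: \<delta>\<^sub>0_def)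
  have below: "C * \<delta> < norm f" "\<delta> < norm f" if "\<delta> \<in> {0<..<\<delta>\<^sub>0}" for \<delta>
  proof -
    show "C * \<delta> < norm f" using that \<open>1 < C\<close> by (simp add: \<delta>\<^sub>0_def field_simps)
    moreover have "\<delta> < C * \<delta>" using that \<open>1 < C\<close> by simp
    ultimately show "\<delta> < norm f" by linarith
  qed
  have "\<exists>a. 0 < a \<and> norm (A (regularized_solution A a f) - f) = C * \<delta> \<and>
      (\<forall>b>0. norm (A (regularized_solution A b f) - f) = C * \<delta> \<longrightarrow> b = a)"
    if "\<delta> \<in> {0<..<\<delta>\<^sub>0}" for \<delta>
  proof -
    have "0 < C * \<delta>" using that \<open>1 < C\<close> by simp
    then have "\<exists>!a. 0 < a \<and> norm (A (regularized_solution A a f) - f) = C * \<delta>"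
      using discrepancy_principle_solvable[OF \<open>bounded_linear A\<close>, of "C * \<delta>" y] below[OF that]
      by (simp add: \<open>f = A y\<close>)
    then show ?thesis by blast
  qed
  then obtain a where a: "\<And>\<delta>. \<delta> \<in> {0<..<\<delta>\<^sub>0} \<Longrightarrow> 0 < a \<delta> \<and>
      norm (A (regularized_solution A (a \<delta>) f) - f) = C * \<delta> \<and>
      (\<forall>b>0. norm (A (regularized_solution A b f) - f) = C * \<delta> \<longrightarrow> b = a \<delta>)"
    by metis
  have "\<forall>\<^sub>F \<delta> in at_right 0. (SUP v\<in>admissible_set A f \<delta>.
      ennreal (norm (regularized_solution A (a \<delta>) f - v))) = top"
    unfolding \<open>f = A y\<close>
    by (rule eventually_at_right_less[THEN eventually_mono])
       (rule SUP_admissible_set_eq_top[OF assms(1,2,4)])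
  then have "((\<lambda>\<delta>. SUP v\<in>admissible_set A f \<delta>.
      ennreal (norm (regularized_solution A (a \<delta>) f - v))) \<longlongrightarrow> top) (at_right 0)"
    by (rule tendsto_eventually)
  then show ?thesis
    using \<open>\<delta>\<^sub>0 > 0\<close> a below(2)
    by (intro exI[of _ \<delta>\<^sub>0] exI[of _ "\<lambda>_. f"] exI[of _ a] conjI exI[of _ "1::real"] exI[of _ top]) auto
qed

end
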